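(* Let $G$ be a finite cubic graph. Let $f,g$ be nowhere-zero $(\mathbb{Z}_2\times\mathbb{Z}_2)$-flows in $G$, and let $c$ and $d$ be the 3-edge-colorings of $G$ corresponding to $f$ and $g$, respectively. Then $f$ and $g$ are in the same connected component of $\mathcal{F}(G,\mathbb{Z}_2\times\mathbb{Z}_2)$ if and only if $c$ and $d$ are in the same connected component of $\mathcal{K}(G,3)$.
   Context: Graphs may have multiple edges but no loops. A $(\mathbb{Z}_2\times\mathbb{Z}_2)$-flow in $G$ is a map $f:E(G)\to\mathbb{Z}_2\times\mathbb{Z}_2$ such that at every vertex the sum of values on incident edges is $0$ (orientations are irrelevant since $a=-a$); it is nowhere-zero if no edge receives $00$. In a cubic graph the three edges at each vertex of a nowhere-zero $(\mathbb{Z}_2\times\mathbb{Z}_2)$-flow receive distinct values, and the 3-edge-coloring corresponding to $f$ is the partition of $E(G)$ into the classes $f^{-1}(01),f^{-1}(10),f^{-1}(11)$, considered as an unlabelled proper 3-edge-coloring. A cycle is a connected 2-regular subgraph. $\mathcal{F}(G,\mathbb{Z}_2\times\mathbb{Z}_2)$ is the graph whose vertices are the nowhere-zero $(\mathbb{Z}_2\times\mathbb{Z}_2)$-flows of $G$, two flows $f,g$ adjacent iff $\{e:(f-g)(e)\ne 0\}$ is the edge set of a cycle. Unlabelled proper 3-edge-colorings are partitions of $E(G)$ into at most 3 matchings, identified up to color permutation. Given such a coloring and two colors $i,j$, a Kempe chain is a connected component of the subgraph formed by the edges colored $i$ or $j$; a Kempe change exchanges $i$ and $j$ on one Kempe chain.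 $\mathcal{K}(G,3)$ is the graph of unlabelled proper 3-edge-colorings of $G$, adjacent iff they differ by one Kempe change. *)

theory Defs
  imports Main "HOL-Library.Z2" "HOL-Library.Product_Plus" "HOL-Library.Disjoint_Sets"
    "HOL-Library.FuncSet" "HOL-Combinatorics.Transposition"
begin

record ('v, 'e) mgraph =
  verts :: "'v set"
  edges :: "'e set"
  ends :: "'e \<Rightarrow> 'v set"

definition multigraph :: "('v, 'e) mgraph \<Rightarrow> bool" where
  "multigraph G \<longleftrightarrow> (\<forall>e \<in> edges G. ends G e \<subseteq> verts G \<and> card (ends G e) = 2)"

definition finite_multigraph :: "('v, 'e) mgraph \<Rightarrow> bool" where
  "finite_multigraph G \<longleftrightarrow> multigraph G \<and> finite (verts G) \<and> finite (edges G)"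

definition incident :: "('v, 'e) mgraph \<Rightarrow> 'v \<Rightarrow> 'e set" where
  "incident G v = {e \<in> edges G. v \<in> ends G e}"

definition regular :: "nat \<Rightarrow> ('v, 'e) mgraph \<Rightarrow> bool" where
  "regular k G \<longleftrightarrow> (\<forall>v \<in> verts G. card (incident G v) = k)"

definition cubic :: "('v, 'e) mgraph \<Rightarrow> bool" where
  "cubic G \<longleftrightarrow> regular 3 G"

definition subgraph :: "('v, 'e) mgraph \<Rightarrow> ('v, 'e) mgraph \<Rightarrow> bool" where
  "subgraph H G \<longleftrightarrow> multigraph H \<and> verts H \<subseteq> verts G \<and> edges H \<subseteq> edges G \<and>
     (\<forall>e \<in> edges H. ends H e = ends G e)"

definition reach :: "('v, 'e) mgraph \<Rightarrow> ('v \<times> 'v) set" where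
  "reach G = {(u, v). \<exists>e \<in> edges G. ends G e = {u, v}}\<^sup>* \<inter> verts G \<times> verts G"

definition connected_graph :: "('v, 'e) mgraph \<Rightarrow> bool" where
  "connected_graph G \<longleftrightarrow> verts G \<noteq> {} \<and> (\<forall>u \<in> verts G. \<forall>v \<in> verts G. (u, v) \<in> reach G)"

definition induced_subgraph :: "('v, 'e) mgraph \<Rightarrow> 'v set \<Rightarrow> ('v, 'e) mgraph" where
  "induced_subgraph G C = \<lparr>verts = C, edges = {e \<in> edges G. ends G e \<subseteq> C}, ends = ends G\<rparr>"

definition components :: "('v, 'e) mgraph \<Rightarrow> ('v, 'e) mgraph set" where
  "components G = induced_subgraph G ` (verts G // reach G)"

definition same_component :: "('v, 'e) mgraph \<Rightarrow> 'v \<Rightarrow> 'v \<Rightarrow> bool" where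
  "same_component G x y \<longleftrightarrow> (\<exists>H \<in> components G. x \<in> verts H \<and> y \<in> verts H)"

definition is_cycle :: "('v, 'e) mgraph \<Rightarrow> ('v, 'e) mgraph \<Rightarrow> bool" where
  "is_cycle G C \<longleftrightarrow> subgraph C G \<and> connected_graph C \<and> regular 2 C"

text \<open>The simple graph on a vertex set \<open>W\<close> given by a (symmetric) adjacency relation; its edges
  are two-element vertex sets.\<close>

definition simple_graph :: "'a set \<Rightarrow> ('a \<Rightarrow> 'a \<Rightarrow> bool) \<Rightarrow> ('a, 'a set) mgraph" where
  "simple_graph W adj =
     \<lparr>verts = W,
      edges = {{x, y} | x y. x \<in> W \<and> y \<in> W \<and> x \<noteq> y \<and> adj x y},
      ends = (\<lambda>e. e)\<rparr>"

text \<open>Maps defined on \<open>E(G)\<close> are functions that are \<open>undefined\<close> outside \<open>edges G\<close>, so that equality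
  of such maps is equality on \<open>E(G)\<close>.\<close>

definition flows :: "('v, 'e) mgraph \<Rightarrow> ('e \<Rightarrow> bit \<times> bit) set" where
  "flows G = {f \<in> edges G \<rightarrow>\<^sub>E UNIV. \<forall>v \<in> verts G. (\<Sum>e \<in> incident G v. f e) = 0}"

definition nowhere_zero_flows :: "('v, 'e) mgraph \<Rightarrow> ('e \<Rightarrow> bit \<times> bit) set" where
  "nowhere_zero_flows G = {f \<in> flows G. \<forall>e \<in> edges G. f e \<noteq> 0}"

definition flow_graph ::
    "('v, 'e) mgraph \<Rightarrow> ('e \<Rightarrow> bit \<times> bit, ('e \<Rightarrow> bit \<times> bit) set) mgraph" where
  "flow_graph G = simple_graph (nowhere_zero_flows G)
     (\<lambda>f g. \<exists>C. is_cycle G C \<and> {e \<in> edges G. f e - g e \<noteq> 0} = edges C)"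

text \<open>In the two definitions of colour classes below the empty set is removed because blocks of a
  partition are nonempty; a colour may be unused.\<close>

definition flow_coloring :: "('v, 'e) mgraph \<Rightarrow> ('e \<Rightarrow> bit \<times> bit) \<Rightarrow> 'e set set" where
  "flow_coloring G f = (\<lambda>a. {e \<in> edges G. f e = a}) ` {(0, 1), (1, 0), (1, 1)} - {{}}"

definition matching :: "('v, 'e) mgraph \<Rightarrow> 'e set \<Rightarrow> bool" where
  "matching G M \<longleftrightarrow> M \<subseteq> edges G \<and> (\<forall>e \<in> M. \<forall>e' \<in> M. e \<noteq> e' \<longrightarrow> ends G e \<inter> ends G e' = {})"

definition unlabelled_colorings :: "('v, 'e) mgraph \<Rightarrow> nat \<Rightarrow> 'e set set set" where
  "unlabelled_colorings G k =
     {P. partition_on (edges G) P \<and> finite P \<and> card P \<le> k \<and> (\<forall>M \<in> P. matching G M)}"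

definition proper_colorings :: "('v, 'e) mgraph \<Rightarrow> nat \<Rightarrow> ('e \<Rightarrow> nat) set" where
  "proper_colorings G k =
     {c \<in> edges G \<rightarrow>\<^sub>E {..<k}. \<forall>i < k. matching G {e \<in> edges G. c e = i}}"

definition color_classes :: "('v, 'e) mgraph \<Rightarrow> nat \<Rightarrow> ('e \<Rightarrow> nat) \<Rightarrow> 'e set set" where
  "color_classes G k c = (\<lambda>i. {e \<in> edges G. c e = i}) ` {..<k} - {{}}"

definition edge_subgraph :: "('v, 'e) mgraph \<Rightarrow> 'e set \<Rightarrow> ('v, 'e) mgraph" where
  "edge_subgraph G D = \<lparr>verts = \<Union> (ends G ` D), edges = D, ends = ends G\<rparr>"

definition kempe_chains ::
    "('v, 'e) mgraph \<Rightarrow> ('e \<Rightarrow> nat) \<Rightarrow> nat \<Rightarrow> nat \<Rightarrow> ('v, 'e) mgraph set" where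
  "kempe_chains G c i j = components (edge_subgraph G {e \<in> edges G. c e \<in> {i, j}})"

definition kempe_change ::
    "('v, 'e) mgraph \<Rightarrow> nat \<Rightarrow> ('e \<Rightarrow> nat) \<Rightarrow> ('e \<Rightarrow> nat) \<Rightarrow> bool" where
  "kempe_change G k c c' \<longleftrightarrow>
     (\<exists>i < k. \<exists>j < k. i \<noteq> j \<and> (\<exists>H \<in> kempe_chains G c i j.
        c' = (\<lambda>e. if e \<in> edges H then transpose i j (c e) else c e)))"

text \<open>The choice of the labelling \<open>c\<close> of the partition \<open>P\<close> is immaterial, as Kempe changes commute
  with permutations of the colours.\<close>

definition kempe_graph :: "('v, 'e) mgraph \<Rightarrow> nat \<Rightarrow> ('e set set, 'e set set set) mgraph" where
  "kempe_graph G k = simple_graph (unlabelled_colorings G k)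
     (\<lambda>P Q. \<exists>c c'. c \<in> proper_colorings G k \<and> color_classes G k c = P \<and>
        kempe_change G k c c' \<and> color_classes G k c' = Q)"

end

theory Submission
  imports Defs
begin

text \<open>
  The difference of two flows adjacent in the flow graph is constant on the cycle supporting it,
  say equal to \<open>a\<close>; as neither flow takes the value \<open>a\<close> there, the cycle is a component of the
  subgraph of edges whose value is not \<open>a\<close>. Conversely, in a cubic graph every such component is a
  cycle, and adding \<open>a\<close> on it exchanges the two other values. Hence adjacency of flows
  is a Kempe change of labelled colourings. Labels do not matter for connectivity:
  transposing two values everywhere amounts to a Kempe change on each chain of these values.
\<close>

section \<open>Reachability\<close>

text \<open>Sending a flow to its colouring is not injective: up to six flows lie over one
  colouring. Connectivity passes between the two graphs because neighbouring flows go to colourings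
  in one component, every Kempe edge lifts to some pair of flows in one component, and the flows
  over a fixed colouring are mutually reachable. The last point is the obstacle: the lift of a Kempe
  edge starts at a flow dictated by the labelling chosen for the Kempe change, in general not at the
  flow reached so far. The comparison rests on the double role of a nonzero value \<open>a\<close>:
  it is the colour missing from a two-coloured chain and also the sum of the two colours present.
  Cubicity makes every nonzero value occur exactly once at each vertex, so deleting the edges of
  value \<open>a\<close> leaves degree two everywhere.\<close>

lemma equiv_reach: "equiv (verts G) (reach G)"
proof (rule equivI)
  show "reach G \<subseteq> verts G \<times> verts G"
    by (auto simp: reach_def)
  show "refl_on (verts G) (reach G)"
    by (auto simp: refl_on_def reach_def)
  have "sym ({(u, v). \<exists>e \<in> edges G. ends G e = {u, v}}\<^sup>*)"
    by (rule sym_rtrancl) (auto simp: sym_def insert_commute)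
  then show "sym (reach G)"
    by (auto simp: reach_def sym_def)
  show "trans (reach G)"
    by (auto simp: reach_def trans_def)
qed

lemma reach_refl: "x \<in> verts G \<Longrightarrow> (x, x) \<in> reach G"
  by (simp add: reach_def)

lemma reach_sym: "(x, y) \<in> reach G \<Longrightarrow> (y, x) \<in> reach G"
  using equiv_reach[of G] by (meson equivE symD)

lemma reach_trans: "(x, y) \<in> reach G \<Longrightarrow> (y, z) \<in> reach G \<Longrightarrow> (x, z) \<in> reach G"
  using equiv_reach[of G] by (meson equivE transD)

text \<open>Components have the equivalence classes of \<open>reach\<close> as vertex sets. With
  this the rest of the argument can work with the equivalence relation alone.\<close>

lemma same_component_iff_reach: "same_component G x y \<longleftrightarrow> (x, y) \<in> reach G"
proof
  assume "same_component G x y"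
  then obtain X where "X \<in> verts G // reach G" "x \<in> X" "y \<in> X"
    by (auto simp: same_component_def components_def induced_subgraph_def)
  then show "(x, y) \<in> reach G"
    using quotient_eq_iff[OF equiv_reach] by metis
next
  assume r: "(x, y) \<in> reach G"
  then have x: "x \<in> verts G"
    by (simp add: reach_def)
  have "induced_subgraph G (reach G `` {x}) \<in> components G"
    using x by (auto simp: components_def quotient_def)
  then show "same_component G x y"
    using r reach_refl[OF x] by (force simp: same_component_def induced_subgraph_def)
qed

lemma reach_step:
  assumes "(x, u) \<in> reach G" "e \<in> edges G" "ends G e = {u, v}" "v \<in> verts G"
  shows "(x, v) \<in> reach G"
proof -
  have "(u, v) \<in> {(u, v). \<exists>e \<in> edges G. ends G e = {u, v}}\<^sup>*"
    using assms by blast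
  then have "(u, v) \<in> reach G"
    using assms by (auto simp: reach_def)
  then show ?thesis
    using assms reach_trans by metis
qed

text \<open>Because \<open>{u, v} = {v, u}\<close>, the single step hypothesis covers an edge
  traversed in either direction.\<close>

lemma reach_invariant [consumes 2, case_names step]:
  assumes "(x, y) \<in> reach G" "P x"
    and step: "\<And>u v e. e \<in> edges G \<Longrightarrow> ends G e = {u, v} \<Longrightarrow> P u \<Longrightarrow> P v"
  shows "P y"
proof -
  have "(x, y) \<in> {(u, v). \<exists>e \<in> edges G. ends G e = {u, v}}\<^sup>*"
    using assms by (simp add: reach_def)
  then show ?thesis
    by (induction rule: rtrancl_induct) (use assms in auto)
qed

section \<open>Components and their edges\<close>

lemma component_cases:
  assumes "H \<in> components G"
  obtains x where "x \<in> verts G" "H = induced_subgraph G (reach G `` {x})"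
  using assms by (auto simp: components_def quotient_def)

text \<open>Distinct classes are disjoint, while an edge has a nonempty set of ends contained in the
  class of its component.\<close>

lemma components_edges_disjoint:
  assumes "multigraph G" "H \<in> components G" "H' \<in> components G" "e \<in> edges H" "e \<in> edges H'"
  shows "H = H'"
proof -
  obtain X X' where X: "X \<in> verts G // reach G" "X' \<in> verts G // reach G"
      "H = induced_subgraph G X" "H' = induced_subgraph G X'"
    using assms by (auto simp: components_def)
  have "e \<in> edges G" "ends G e \<subseteq> X \<inter> X'"
    using assms X by (auto simp: induced_subgraph_def)
  moreover from this have "ends G e \<noteq> {}"
    using assms(1) by (force simp: multigraph_def)
  ultimately have "X = X'"
    using quotient_disj[OF equiv_reach X(1,2)] by blast
  then show ?thesis
    using X by simp
qed

lemma components_edges_cover: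
  assumes "multigraph G"
  shows "(\<Union>H \<in> components G. edges H) = edges G"
proof
  show "(\<Union>H \<in> components G. edges H) \<subseteq> edges G"
    by (auto simp: components_def induced_subgraph_def)
  show "edges G \<subseteq> (\<Union>H \<in> components G. edges H)"
  proof
    fix e assume e: "e \<in> edges G"
    then obtain u v where uv: "ends G e = {u, v}" "u \<in> verts G" "v \<in> verts G"
      using assms by (force simp: multigraph_def card_2_iff)
    have "(u, v) \<in> reach G"
      using reach_step[OF reach_refl] e uv by metis
    then have "e \<in> edges (induced_subgraph G (reach G `` {u}))"
      using e uv reach_refl by (auto simp: induced_subgraph_def)
    moreover have "induced_subgraph G (reach G `` {u}) \<in> components G"
      using uv by (auto simp: components_def quotient_def)
    ultimately show "e \<in> (\<Union>H \<in> components G. edges H)"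
      by blast
  qed
qed

text \<open>Reachability has to be re-established inside \<open>H\<close>: a walk of
  \<open>G\<close> from the base point \<open>x\<close> never leaves the class of \<open>x\<close>,
  so all its edges survive in the induced subgraph.\<close>

lemma connected_component:
  assumes "multigraph G" "H \<in> components G"
  shows "connected_graph H"
proof -
  from assms(2) obtain x where x: "x \<in> verts G" and H: "H = induced_subgraph G (reach G `` {x})"
    by (rule component_cases)
  have xH: "x \<in> verts H"
    using x reach_refl by (auto simp: H induced_subgraph_def)
  have "(x, y) \<in> reach H" if "(x, y) \<in> reach G" for y
    using that
  proof (rule reach_invariant[where P = "\<lambda>y. (x, y) \<in> reach H"])
    show "(x, x) \<in> reach H"
      using xH by (rule reach_refl)
  next
    fix u v e
    assume e: "e \<in> edges G" "ends G e = {u, v}" and u: "(x, u) \<in> reach H"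
    then have "(x, u) \<in> reach G"
      by (auto simp: reach_def H induced_subgraph_def)
    moreover have "v \<in> verts G"
      using e assms(1) by (auto simp: multigraph_def)
    ultimately have "(x, v) \<in> reach G" "(x, u) \<in> reach G"
      using reach_step e by metis+
    then show "(x, v) \<in> reach H"
      using e by (intro reach_step[OF u, of e]) (auto simp: H induced_subgraph_def)
  qed
  then have "(x, y) \<in> reach H" if "y \<in> verts H" for y
    using that by (simp add: H induced_subgraph_def)
  then show ?thesis
    using xH reach_sym reach_trans unfolding connected_graph_def by (metis empty_iff)
qed

lemma multigraph_edge_subgraph:
  "multigraph G \<Longrightarrow> D \<subseteq> edges G \<Longrightarrow> multigraph (edge_subgraph G D)"
  by (auto simp: multigraph_def edge_subgraph_def)

text \<open>Edges are unordered pairs, and \<open>adj\<close> is not assumed symmetric, so a step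
  may use adjacency in either order.\<close>

lemma simple_graph_reach_invariant:
  assumes "(x, y) \<in> reach (simple_graph W adj)" "P x"
    and "\<And>u v. u \<in> W \<Longrightarrow> v \<in> W \<Longrightarrow> adj u v \<or> adj v u \<Longrightarrow> P u \<Longrightarrow> P v"
  shows "P y"
  using assms(1,2)
proof (rule reach_invariant)
  fix u v e
  assume "e \<in> edges (simple_graph W adj)" "ends (simple_graph W adj) e = {u, v}" "P u"
  then show "P v"
    using assms(3)[of u v] by (auto simp: simple_graph_def doubleton_eq_iff)
qed

text \<open>The case \<open>x = y\<close> is real: exchanging two colours on the only chain of these
  colours leaves the unlabelled colouring unchanged, which gives no edge but trivial
  reachability.\<close>

lemma simple_graph_reach_adj:
  assumes "x \<in> W" "y \<in> W" "adj x y"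
  shows "(x, y) \<in> reach (simple_graph W adj)"
proof (cases "x = y")
  case True
  then show ?thesis
    using assms by (simp add: reach_def simple_graph_def)
next
  case False
  have "(x, x) \<in> reach (simple_graph W adj)"
    using assms by (simp add: reach_def simple_graph_def)
  then show ?thesis
    using False assms
    by (elim reach_step[where e = "{x, y}"]) (auto simp: simple_graph_def)
qed

section \<open>The Klein four-group\<close>

lemma klein_zero: "(0 :: bit \<times> bit) = (0, 0)"
  by (simp add: zero_prod_def)

lemma klein_cases:
  fixes x :: "bit \<times> bit"
  obtains "x = (0, 0)" | "x = (0, 1)" | "x = (1, 0)" | "x = (1, 1)"
  by (cases x) (metis bit.exhaust)

lemma klein_nonzero_iff: "(x :: bit \<times> bit) \<noteq> 0 \<longleftrightarrow> x \<in> {(0, 1), (1, 0), (1, 1)}"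
  by (cases x rule: klein_cases) (auto simp: klein_zero)

lemma klein_diff: "(x :: bit \<times> bit) - y = x + y"
  by (cases x rule: klein_cases; cases y rule: klein_cases) (auto simp: klein_zero)

lemma klein_add_eq_0_iff: "(x :: bit \<times> bit) + y = 0 \<longleftrightarrow> x = y"
  by (cases x rule: klein_cases; cases y rule: klein_cases) (auto simp: klein_zero)

lemma klein_add_cancel: "(x :: bit \<times> bit) + y + y = x"
  by (cases x rule: klein_cases; cases y rule: klein_cases) (auto simp: klein_zero)

text \<open>The three nonzero elements sum to zero, and every element is its own inverse, so two of
  them determine the third.\<close>

lemma klein_third:
  fixes a b x :: "bit \<times> bit"
  assumes "a \<noteq> 0" "b \<noteq> 0" "x \<noteq> 0" "a \<noteq> b" "x \<noteq> a" "x \<noteq> b"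
  shows "x = a + b"
  using assms
  by (cases x rule: klein_cases; cases a rule: klein_cases; cases b rule: klein_cases)
    (auto simp: klein_zero)

section \<open>Switching a flow along a two-valued chain\<close>

text \<open>For a nowhere-zero flow and nonzero \<open>a\<close> this is the union of the Kempe
  chains of the two colours other than \<open>a\<close>. Indexing by the missing value is convenient
  because adding that same value exchanges the two others.\<close>

definition two_valued_subgraph ::
    "('v, 'e) mgraph \<Rightarrow> ('e \<Rightarrow> bit \<times> bit) \<Rightarrow> bit \<times> bit \<Rightarrow> ('v, 'e) mgraph" where
  "two_valued_subgraph G f a = edge_subgraph G {e \<in> edges G. f e \<noteq> a}"

text \<open>The restriction to \<open>edges G\<close> keeps the result \<open>undefined\<close>
  elsewhere, as membership in \<open>flows\<close> demands.\<close>

definition switch ::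
    "('v, 'e) mgraph \<Rightarrow> ('e \<Rightarrow> bit \<times> bit) \<Rightarrow> bit \<times> bit \<Rightarrow> 'e set \<Rightarrow> 'e \<Rightarrow> bit \<times> bit" where
  "switch G f a D = (\<lambda>e \<in> edges G. if e \<in> D then f e + a else f e)"

locale finite_cubic_graph =
  fixes G :: "('v, 'e) mgraph"
  assumes finite_multigraph: "finite_multigraph G" and cubic: "cubic G"
begin

lemma multigraph: "multigraph G"
  using finite_multigraph by (simp add: finite_multigraph_def)

lemma finite_edges: "finite (edges G)"
  using finite_multigraph by (simp add: finite_multigraph_def)

lemma finite_incident: "finite (incident G v)"
  using finite_edges by (simp add: incident_def)

lemma edge_ends:
  assumes "e \<in> edges G"
  obtains u v where "ends G e = {u, v}" "u \<noteq> v" "u \<in> verts G" "v \<in> verts G"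
    "e \<in> incident G u" "e \<in> incident G v"
  using assms multigraph by (force simp: multigraph_def card_2_iff incident_def)

lemma incident_three:
  assumes "v \<in> verts G"
  obtains x y z where "incident G v = {x, y, z}" "x \<noteq> y" "x \<noteq> z" "y \<noteq> z"
proof -
  have "card (incident G v) = 3"
    using assms cubic by (simp add: cubic_def regular_def)
  then show ?thesis
    using that by (auto simp: card_3_iff)
qed

lemma nowhere_zero_flow_values:
  assumes "f \<in> nowhere_zero_flows G" "e \<in> edges G"
  shows "f e \<noteq> 0"
  using assms by (simp add: nowhere_zero_flows_def)

text \<open>Three nonzero elements of the Klein four-group sum to zero iff they are distinct.\<close>

lemma nowhere_zero_flow_iff:
  "f \<in> nowhere_zero_flows G \<longleftrightarrow>
    f \<in> edges G \<rightarrow>\<^sub>E UNIV \<and> (\<forall>e \<in> edges G. f e \<noteq> 0) \<and> (\<forall>v \<in> verts G. inj_on f (incident G v))"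
proof -
  have "(\<Sum>e \<in> incident G v. f e) = 0 \<longleftrightarrow> inj_on f (incident G v)"
    if v: "v \<in> verts G" and nz: "\<forall>e \<in> edges G. f e \<noteq> 0" for v
  proof -
    obtain x y z where xyz: "incident G v = {x, y, z}" "x \<noteq> y" "x \<noteq> z" "y \<noteq> z"
      using incident_three[OF v] .
    then have "x \<in> edges G" "y \<in> edges G" "z \<in> edges G"
      by (auto simp: incident_def)
    then have "f x \<noteq> 0" "f y \<noteq> 0" "f z \<noteq> 0"
      using nz by auto
    then have "f x + (f y + f z) = 0 \<longleftrightarrow> f x \<noteq> f y \<and> f x \<noteq> f z \<and> f y \<noteq> f z"
      by (cases "f x" rule: klein_cases; cases "f y" rule: klein_cases;
          cases "f z" rule: klein_cases) (auto simp: klein_zero)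
    then show ?thesis
      using xyz by (auto simp: inj_on_def)
  qed
  then show ?thesis
    unfolding nowhere_zero_flows_def flows_def by blast
qed

lemma inj_on_incident:
  "f \<in> nowhere_zero_flows G \<Longrightarrow> v \<in> verts G \<Longrightarrow> inj_on f (incident G v)"
  by (simp add: nowhere_zero_flow_iff)

text \<open>Three edges with distinct values and only three nonzero values available: every value
  must occur.\<close>

lemma image_incident:
  assumes "f \<in> nowhere_zero_flows G" "v \<in> verts G"
  shows "f ` incident G v = {(0, 1), (1, 0), (1, 1)}"
proof (rule card_subset_eq)
  have "card (f ` incident G v) = 3"
    using card_image[OF inj_on_incident[OF assms]] assms(2) cubic
    by (simp add: cubic_def regular_def)
  then show "card (f ` incident G v) = card {(0, 1 :: bit), (1 :: bit, 0), (1, 1)}"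
    by simp
  show "f ` incident G v \<subseteq> {(0, 1), (1, 0), (1, 1)}"
    using nowhere_zero_flow_values[OF assms(1)] klein_nonzero_iff
    by (fastforce simp: incident_def)
qed simp

lemma incident_value:
  assumes "f \<in> nowhere_zero_flows G" "v \<in> verts G" "a \<noteq> 0"
  obtains e where "e \<in> incident G v" "f e = a"
  using image_incident[OF assms(1,2)] assms(3) klein_nonzero_iff by (metis imageE)

lemma card_incident_two_valued:
  assumes "f \<in> nowhere_zero_flows G" "v \<in> verts G" "a \<noteq> 0"
  shows "card {e \<in> incident G v. f e \<noteq> a} = 2"
proof -
  obtain x where x: "x \<in> incident G v" "f x = a"
    using incident_value[OF assms] .
  have "{e \<in> incident G v. f e \<noteq> a} = incident G v - {x}"
    using x inj_on_incident[OF assms(1,2)] by (auto simp: inj_on_def)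
  then show ?thesis
    using x assms(2) cubic by (simp add: cubic_def regular_def)
qed

section \<open>Components of the two-valued subgraphs\<close>

lemma multigraph_two_valued: "multigraph (two_valued_subgraph G f a)"
  unfolding two_valued_subgraph_def by (rule multigraph_edge_subgraph[OF multigraph]) auto

lemma edges_two_valued: "edges (two_valued_subgraph G f a) = {e \<in> edges G. f e \<noteq> a}"
  by (simp add: two_valued_subgraph_def edge_subgraph_def)

lemma ends_two_valued: "ends (two_valued_subgraph G f a) = ends G"
  by (simp add: two_valued_subgraph_def edge_subgraph_def)

lemma verts_two_valued_subset: "verts (two_valued_subgraph G f a) \<subseteq> verts G"
  using multigraph by (auto simp: two_valued_subgraph_def edge_subgraph_def multigraph_def)

lemma finite_components_two_valued: "finite (components (two_valued_subgraph G f a))"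
proof -
  have "finite (verts (two_valued_subgraph G f a))"
    using finite_subset[OF verts_two_valued_subset] finite_multigraph
    by (auto simp: finite_multigraph_def)
  then show ?thesis
    unfolding components_def by (intro finite_imageI finite_quotient) (auto simp: reach_def)
qed

text \<open>A component is closed under the edges of the two-valued subgraph at its vertices: the
  edge itself makes its other end reachable, so both ends lie in the class.\<close>

lemma component_two_valued_edge:
  assumes "H \<in> components (two_valued_subgraph G f a)" "e \<in> edges G" "f e \<noteq> a"
    "v \<in> ends G e" "v \<in> verts H"
  shows "e \<in> edges H"
proof -
  from assms(1) obtain x where H: "H = induced_subgraph (two_valued_subgraph G f a)
      (reach (two_valued_subgraph G f a) `` {x})"
    by (rule component_cases)
  let ?T = "two_valued_subgraph G f a"
  have e: "e \<in> edges ?T"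
    using assms by (simp add: edges_two_valued)
  have "(x, w) \<in> reach ?T" if w: "w \<in> ends G e" for w
  proof (cases "w = v")
    case True
    then show ?thesis
      using assms by (simp add: H induced_subgraph_def)
  next
    case False
    have "card (ends G e) = 2"
      using assms(2) multigraph by (simp add: multigraph_def)
    then have "ends ?T e = {v, w}"
      using False w assms(4) by (auto simp: card_2_iff ends_two_valued)
    moreover have "w \<in> verts ?T"
      using w e multigraph_two_valued[of f a] by (auto simp: multigraph_def ends_two_valued)
    moreover have "(x, v) \<in> reach ?T"
      using assms by (simp add: H induced_subgraph_def)
    ultimately show ?thesis
      using reach_step e by metis
  qed
  then show ?thesis
    using e by (auto simp: H induced_subgraph_def ends_two_valued)
qed

lemma component_two_valued_basics:
  assumes "H \<in> components (two_valued_subgraph G f a)"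
  shows "verts H \<subseteq> verts G" "edges H \<subseteq> {e \<in> edges G. f e \<noteq> a}" "ends H = ends G"
    "e \<in> edges H \<Longrightarrow> ends G e \<subseteq> verts H"
proof -
  from assms obtain x where H: "H = induced_subgraph (two_valued_subgraph G f a)
      (reach (two_valued_subgraph G f a) `` {x})"
    by (rule component_cases)
  show "verts H \<subseteq> verts G"
    using verts_two_valued_subset by (fastforce simp: H induced_subgraph_def reach_def)
  show "edges H \<subseteq> {e \<in> edges G. f e \<noteq> a}"
    by (auto simp: H induced_subgraph_def edges_two_valued)
  show "ends H = ends G"
    by (simp add: H induced_subgraph_def ends_two_valued)
  show "e \<in> edges H \<Longrightarrow> ends G e \<subseteq> verts H"
    by (simp add: H induced_subgraph_def ends_two_valued)
qed

text \<open>Of the three edges at a vertex of \<open>H\<close> exactly one has value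
  \<open>a\<close>; the other two belong to \<open>H\<close> by closedness, which gives
  2-regularity.\<close>

lemma is_cycle_component_two_valued:
  assumes "f \<in> nowhere_zero_flows G" "a \<noteq> 0" "H \<in> components (two_valued_subgraph G f a)"
  shows "is_cycle G H"
proof -
  note basics = component_two_valued_basics[OF assms(3)]
  have "connected_graph H"
    using connected_component[OF multigraph_two_valued assms(3)] .
  moreover have "subgraph H G"
    using basics multigraph by (auto simp: subgraph_def multigraph_def)
  moreover have "incident H v = {e \<in> incident G v. f e \<noteq> a}" if "v \<in> verts H" for v
    using basics component_two_valued_edge[OF assms(3) _ _ _ that]
    by (auto simp: incident_def)
  then have "regular 2 H"
    using card_incident_two_valued[OF assms(1) _ assms(2)] basics(1)
    by (auto simp: regular_def)
  ultimately show ?thesis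
    by (simp add: is_cycle_def)
qed

text \<open>A value could become zero only where \<open>f e = a\<close>, which is excluded on
  \<open>H\<close>. At a vertex, two switched or two unswitched edges keep distinct values, so only
  a mixed pair needs an argument.\<close>

lemma switch_nowhere_zero_flow:
  assumes f: "f \<in> nowhere_zero_flows G" and a: "a \<noteq> 0"
    and H: "H \<in> components (two_valued_subgraph G f a)"
  shows "switch G f a (edges H) \<in> nowhere_zero_flows G"
proof -
  note basics = component_two_valued_basics[OF H]
  let ?g = "switch G f a (edges H)"
  have "?g e \<noteq> 0" if "e \<in> edges G" for e
    using that basics(2) nowhere_zero_flow_values[OF f that]
    by (auto simp: switch_def klein_add_eq_0_iff)
  moreover have "inj_on ?g (incident G v)" if v: "v \<in> verts G" for v
  proof (rule inj_onI)
    fix x y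
    assume xy: "x \<in> incident G v" "y \<in> incident G v" and eq: "?g x = ?g y"
    have E: "x \<in> edges G" "y \<in> edges G" "v \<in> ends G x" "v \<in> ends G y"
      using xy by (auto simp: incident_def)
    have inj: "f x = f y \<Longrightarrow> x = y"
      using inj_on_incident[OF f v] xy by (auto simp: inj_on_def)
    \<comment> \<open>A mixed clash: \<open>s\<close> places \<open>v\<close> on \<open>H\<close>,
      so \<open>t\<close>, being outside \<open>H\<close>, must have value \<open>a\<close>; then
      \<open>f s + a = a\<close> forces \<open>f s = 0\<close>.\<close>
    have *: False
      if "s \<in> edges H" "t \<notin> edges H" "t \<in> edges G" "s \<in> edges G" "v \<in> ends G s" "v \<in> ends G t"
        "f s + a = f t" for s t
    proof -
      have "v \<in> verts H"
        using basics(4) that by blast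
      then have "f t = a"
        using component_two_valued_edge[OF H] that by blast
      then have "f s = 0"
        using that(7) by simp
      then show False
        using nowhere_zero_flow_values[OF f] that by blast
    qed
    show "x = y"
      using eq E inj *[of x y] *[of y x] by (auto simp: switch_def split: if_splits)
  qed
  ultimately show ?thesis
    by (auto simp: nowhere_zero_flow_iff switch_def)
qed

lemma switch_reach:
  assumes "f \<in> nowhere_zero_flows G" "a \<noteq> 0" "H \<in> components (two_valued_subgraph G f a)"
  shows "(f, switch G f a (edges H)) \<in> reach (flow_graph G)"
  unfolding flow_graph_def
proof (rule simple_graph_reach_adj)
  have "{e \<in> edges G. f e - switch G f a (edges H) e \<noteq> 0} = edges H"
    using component_two_valued_basics(2)[OF assms(3)] assms(2)
    by (auto simp: switch_def klein_diff klein_add_eq_0_iff)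
  then show "\<exists>C. is_cycle G C \<and>
      {e \<in> edges G. f e - switch G f a (edges H) e \<noteq> 0} = edges C"
    using is_cycle_component_two_valued[OF assms] by blast
qed (use assms switch_nowhere_zero_flow in auto)

text \<open>Adjacency of flows speaks of an arbitrary cycle. This replaces it by a switch on a
  component determined by \<open>f\<close> and a value, the form in which it can be compared with a
  Kempe change.\<close>

lemma cycle_difference_is_switch:
  assumes f: "f \<in> nowhere_zero_flows G" and g: "g \<in> nowhere_zero_flows G"
    and C: "is_cycle G C" and diff: "{e \<in> edges G. f e - g e \<noteq> 0} = edges C"
  obtains a H where "a \<noteq> 0" "H \<in> components (two_valued_subgraph G f a)"
    "g = switch G f a (edges H)"
proof -
  have sub: "verts C \<subseteq> verts G" "edges C \<subseteq> edges G" "\<And>e. e \<in> edges C \<Longrightarrow> ends C e = ends G e"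
    and mC: "multigraph C" and conn: "connected_graph C" and reg: "regular 2 C"
    using C by (auto simp: is_cycle_def subgraph_def)
  have inc: "incident C v \<subseteq> incident G v" for v
    using sub by (auto simp: incident_def)
  define h where "h e = f e + g e" for e
  have hC: "e \<in> edges C \<longleftrightarrow> h e \<noteq> 0" if "e \<in> edges G" for e
    using that diff by (auto simp: h_def klein_diff)
  \<comment> \<open>The values of \<open>h\<close> at \<open>v\<close> sum to zero and only the two
    edges of \<open>C\<close> at \<open>v\<close> contribute; as every element is its own inverse,
    these two carry equal values.\<close>
  have local: "h x = h y" if v: "v \<in> verts C" and xy: "x \<in> incident C v" "y \<in> incident C v"
    for v x y
  proof (cases "x = y")
    case False
    have "card (incident C v) = 2"
      using reg v by (simp add: regular_def)
    then have eq: "incident C v = {x, y}"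
      using xy False by (auto simp: card_2_iff)
    have "(\<Sum>e \<in> incident G v. h e) = (\<Sum>e \<in> incident G v. f e) + (\<Sum>e \<in> incident G v. g e)"
      by (simp add: h_def sum.distrib)
    also have "\<dots> = 0"
      using f g v sub(1) by (auto simp: nowhere_zero_flows_def flows_def)
    finally have "(\<Sum>e \<in> incident G v. h e) = 0" .
    moreover have "(\<Sum>e \<in> incident G v. h e) = (\<Sum>e \<in> incident C v. h e)"
    proof (rule sum.mono_neutral_right[OF finite_incident inc])
      show "\<forall>e \<in> incident G v - incident C v. h e = 0"
        using hC sub by (auto simp: incident_def)
    qed
    ultimately have "h x + h y = 0"
      using eq False by simp
    then show ?thesis
      by (simp add: klein_add_eq_0_iff)
  qed simp
  obtain v0 where v0: "v0 \<in> verts C"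
    using conn by (auto simp: connected_graph_def)
  then have "card (incident C v0) = 2"
    using reg by (simp add: regular_def)
  then obtain e0 where e0: "e0 \<in> incident C v0"
    by fastforce
  define a where "a = h e0"
  have a: "a \<noteq> 0"
    using e0 hC sub by (auto simp: a_def incident_def)
  have ha_vert: "\<forall>e \<in> incident C v. h e = a" if "v \<in> verts C" for v
  proof -
    have "(v0, v) \<in> reach C"
      using conn v0 that by (simp add: connected_graph_def)
    then show ?thesis
    proof (rule reach_invariant[where P = "\<lambda>v. \<forall>e \<in> incident C v. h e = a"])
      show "\<forall>e \<in> incident C v0. h e = a"
        using local[OF v0 _ e0] by (simp add: a_def)
    next
      fix u v e
      assume e: "e \<in> edges C" "ends C e = {u, v}" and u: "\<forall>e \<in> incident C u. h e = a"
      have "v \<in> verts C" "e \<in> incident C u" "e \<in> incident C v"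
        using e mC by (auto simp: multigraph_def incident_def)
      then show "\<forall>e \<in> incident C v. h e = a"
        using local u by metis
    qed
  qed
  have ha: "h e = a" if e: "e \<in> edges C" for e
  proof -
    have "ends C e \<noteq> {}" "ends C e \<subseteq> verts C"
      using e mC by (force simp: multigraph_def)+
    then show ?thesis
      using ha_vert e by (auto simp: incident_def)
  qed
  have gf: "g e = f e + h e" for e
    by (metis h_def klein_add_cancel add.commute)
  \<comment> \<open>If \<open>f\<close> had value \<open>a\<close> on an edge of \<open>C\<close>,
    the flow \<open>g\<close> would vanish there.\<close>
  have fa: "f e \<noteq> a" if "e \<in> edges C" for e
  proof
    assume "f e = a"
    then have "g e = 0"
      using gf[of e] ha[OF that] klein_add_eq_0_iff by simp
    then show False
      using nowhere_zero_flow_values[OF g] that sub by blast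
  qed
  let ?T = "two_valued_subgraph G f a"
  have CT: "edges C \<subseteq> edges ?T"
    using fa sub by (auto simp: edges_two_valued)
  \<comment> \<open>Both sets have two elements and one contains the other: at its vertices
    \<open>C\<close> already uses every edge whose value is not \<open>a\<close>.\<close>
  have incC: "{e \<in> incident G v. f e \<noteq> a} = incident C v" if v: "v \<in> verts C" for v
  proof (rule card_subset_eq[symmetric])
    show "finite {e \<in> incident G v. f e \<noteq> a}"
      using finite_incident by simp
    show "incident C v \<subseteq> {e \<in> incident G v. f e \<noteq> a}"
      using inc fa by (auto simp: incident_def)
    show "card (incident C v) = card {e \<in> incident G v. f e \<noteq> a}"
      using card_incident_two_valued[OF f _ a] v sub reg by (auto simp: regular_def)
  qed
  have closed: "e \<in> edges C" if "v \<in> verts C" "e \<in> edges ?T" "v \<in> ends G e" for v e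
    using incC[OF that(1)] that(2,3) by (auto simp: incident_def edges_two_valued)
  have vCT: "verts C \<subseteq> verts ?T"
  proof
    fix v assume v: "v \<in> verts C"
    then have "card (incident C v) = 2"
      using reg by (simp add: regular_def)
    then obtain e where "e \<in> incident C v"
      by fastforce
    then have "e \<in> edges ?T" "v \<in> ends ?T e"
      using CT sub(3)[of e] by (auto simp: incident_def ends_two_valued)
    then show "v \<in> verts ?T"
      using multigraph_two_valued[of f a] unfolding multigraph_def by blast
  qed
  \<comment> \<open>One inclusion holds because \<open>C\<close> is closed under the edges of
    \<open>?T\<close>, the other because \<open>C\<close> is connected inside
    \<open>?T\<close>.\<close>
  have X: "reach ?T `` {v0} = verts C"
  proof (intro equalityI subsetI)
    fix v assume "v \<in> reach ?T `` {v0}"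
    then have "(v0, v) \<in> reach ?T"
      by simp
    then show "v \<in> verts C"
    proof (rule reach_invariant[where P = "\<lambda>v. v \<in> verts C"])
      fix u v e
      assume e: "e \<in> edges ?T" "ends ?T e = {u, v}" and u: "u \<in> verts C"
      have "e \<in> edges C"
        using closed[OF u e(1)] e(2) by (simp add: ends_two_valued)
      then have "ends G e \<subseteq> verts C"
        using mC sub by (auto simp: multigraph_def)
      then show "v \<in> verts C"
        using e(2) by (simp add: ends_two_valued)
    qed (rule v0)
  next
    fix v assume "v \<in> verts C"
    then have "(v0, v) \<in> reach C"
      using conn v0 by (simp add: connected_graph_def)
    moreover have "(v0, v0) \<in> reach ?T"
      by (rule reach_refl) (use v0 vCT in blast)
    ultimately have "(v0, v) \<in> reach ?T"
    proof (rule reach_invariant[where P = "\<lambda>v. (v0, v) \<in> reach ?T"])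
      fix u v e
      assume e: "e \<in> edges C" "ends C e = {u, v}" and u: "(v0, u) \<in> reach ?T"
      have "ends C e \<subseteq> verts C"
        using e(1) mC by (simp add: multigraph_def)
      then have "v \<in> verts ?T"
        using e(2) vCT by blast
      moreover have "e \<in> edges ?T"
        using CT e(1) by blast
      moreover have "ends ?T e = {u, v}"
        using e sub(3)[OF e(1)] by (simp add: ends_two_valued)
      ultimately show "(v0, v) \<in> reach ?T"
        using reach_step[OF u] by metis
    qed
    then show "v \<in> reach ?T `` {v0}"
      by simp
  qed
  \<comment> \<open>\<open>C\<close> need not equal the component as a record, since its
    \<open>ends\<close> may differ from \<open>ends G\<close> outside \<open>edges C\<close>. The
    component is therefore rebuilt from the vertex set, and only the edge sets are compared.\<close>
  define H where "H = induced_subgraph ?T (verts C)"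
  have "H \<in> components ?T"
    using X v0 vCT by (auto simp: H_def components_def quotient_def)
  moreover have "edges H = edges C"
  proof (intro equalityI subsetI)
    fix e assume "e \<in> edges H"
    then have e: "e \<in> edges ?T" "ends G e \<subseteq> verts C"
      by (auto simp: H_def induced_subgraph_def ends_two_valued)
    moreover have "ends G e \<noteq> {}"
      using e(1) multigraph by (force simp: multigraph_def edges_two_valued)
    ultimately show "e \<in> edges C"
      using closed by blast
  next
    fix e assume "e \<in> edges C"
    then show "e \<in> edges H"
      using CT sub(3) mC by (auto simp: H_def induced_subgraph_def ends_two_valued multigraph_def)
  qed
  moreover have "g = switch G f a (edges C)"
  proof
    fix e
    show "g e = switch G f a (edges C) e"
    proof (cases "e \<in> edges G")
      case True
      then show ?thesis
        using gf[of e] ha[of e] hC[of e] by (auto simp: switch_def)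
    next
      case False
      then show ?thesis
        using g by (auto simp: switch_def nowhere_zero_flows_def flows_def)
    qed
  qed
  ultimately show ?thesis
    using that a by metis
qed

section \<open>Relabelling\<close>

text \<open>This exchanges two colours globally by switching one component after another. The order
  is harmless: a switch leaves the set of edges of value \<open>a\<close> unchanged, so the
  remaining components are still components for the new flow.\<close>

lemma switch_all_reach:
  assumes f: "f \<in> nowhere_zero_flows G" and a: "a \<noteq> 0"
  shows "(f, switch G f a {e \<in> edges G. f e \<noteq> a}) \<in> reach (flow_graph G)"
    and "switch G f a {e \<in> edges G. f e \<noteq> a} \<in> nowhere_zero_flows G"
proof -
  let ?K = "components (two_valued_subgraph G f a)"
  have "S \<subseteq> ?K \<longrightarrow> switch G f a (\<Union>(edges ` S)) \<in> nowhere_zero_flows G \<and>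
      (f, switch G f a (\<Union>(edges ` S))) \<in> reach (flow_graph G)"
    if "finite S" for S
    using that
  proof (induction S rule: finite_induct)
    case empty
    have "switch G f a {} = f"
      using f by (auto simp: switch_def nowhere_zero_flows_def flows_def PiE_iff extensional_def)
    then show ?case
      using f reach_refl[of f "flow_graph G"] by (simp add: flow_graph_def simple_graph_def)
  next
    case (insert H S)
    show ?case
    proof
      assume S: "insert H S \<subseteq> ?K"
      let ?f = "switch G f a (\<Union>(edges ` S))"
      have IH: "?f \<in> nowhere_zero_flows G" "(f, ?f) \<in> reach (flow_graph G)"
        using S insert.IH by auto
      have "?f e = a \<longleftrightarrow> f e = a" if e: "e \<in> edges G" for e
      proof (cases "e \<in> \<Union>(edges ` S)")
        case True
        then have "f e \<noteq> a"
          using S component_two_valued_basics(2) by fastforce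
        moreover have "f e + a \<noteq> a"
          using nowhere_zero_flow_values[OF f e] by simp
        ultimately show ?thesis
          using True e by (simp add: switch_def)
      qed (use e in \<open>simp add: switch_def\<close>)
      then have "two_valued_subgraph G ?f a = two_valued_subgraph G f a"
        unfolding two_valued_subgraph_def by (intro arg_cong[where f = "edge_subgraph G"]) blast
      then have H: "H \<in> components (two_valued_subgraph G ?f a)"
        using S by simp
      \<comment> \<open>Disjointness guarantees that no edge is switched twice.\<close>
      have "edges H \<inter> \<Union>(edges ` S) = {}"
        using components_edges_disjoint[OF multigraph_two_valued] S insert.hyps(2) by blast
      then have "switch G ?f a (edges H) = switch G f a (\<Union>(edges ` insert H S))"
        by (fastforce simp: switch_def)
      then show "switch G f a (\<Union>(edges ` insert H S)) \<in> nowhere_zero_flows G \<and>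
          (f, switch G f a (\<Union>(edges ` insert H S))) \<in> reach (flow_graph G)"
        using switch_nowhere_zero_flow[OF IH(1) a H] switch_reach[OF IH(1) a H] IH(2)
          reach_trans by metis
    qed
  qed
  from this[OF finite_components_two_valued[of f a]]
  show "(f, switch G f a {e \<in> edges G. f e \<noteq> a}) \<in> reach (flow_graph G)"
    and "switch G f a {e \<in> edges G. f e \<noteq> a} \<in> nowhere_zero_flows G"
    using components_edges_cover[OF multigraph_two_valued, of f a] by (auto simp: edges_two_valued)
qed

text \<open>An unlabelled colouring remembers only which edges share a value: the class of
  \<open>e\<close> under \<open>f\<close> is nonempty, hence a block, hence also a class of
  \<open>g\<close>.\<close>

lemma flow_coloring_same_value:
  assumes f: "f \<in> nowhere_zero_flows G" and g: "g \<in> nowhere_zero_flows G"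
    and eq: "flow_coloring G f = flow_coloring G g"
    and e: "e \<in> edges G" "e' \<in> edges G" "f e = f e'"
  shows "g e = g e'"
proof -
  let ?B = "{x \<in> edges G. f x = f e}"
  have "f e \<in> {(0, 1), (1, 0), (1, 1)}"
    using nowhere_zero_flow_values[OF f e(1)] klein_nonzero_iff by blast
  then have "?B \<in> flow_coloring G f"
    using e(1) unfolding flow_coloring_def by blast
  then obtain b where "?B = {x \<in> edges G. g x = b}"
    unfolding eq unfolding flow_coloring_def by blast
  then have "e \<in> {x \<in> edges G. g x = b}" "e' \<in> {x \<in> edges G. g x = b}"
    using e by auto
  then show ?thesis
    by simp
qed

text \<open>One transposition makes \<open>f\<close> agree with \<open>g\<close> on one class, a second one on all classes.\<close>

lemma same_flow_coloring_reach:
  assumes f: "f \<in> nowhere_zero_flows G" and g: "g \<in> nowhere_zero_flows G"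
    and eq: "flow_coloring G f = flow_coloring G g"
  shows "(f, g) \<in> reach (flow_graph G)"
proof -
  have refl: "(f, f) \<in> reach (flow_graph G)" if "f \<in> nowhere_zero_flows G" for f
    using that reach_refl[of f "flow_graph G"] by (simp add: flow_graph_def simple_graph_def)
  have ext: "h = k" if "h \<in> nowhere_zero_flows G" "k \<in> nowhere_zero_flows G"
    "\<And>e. e \<in> edges G \<Longrightarrow> h e = k e" for h k
    using that by (auto simp: nowhere_zero_flow_iff intro: PiE_ext)
  show ?thesis
  \<comment> \<open>Without edges there is no vertex at which to read off the values, and all flows
    coincide.\<close>
  proof (cases "edges G = {}")
    case True
    then show ?thesis
      using ext[OF f g] refl[OF f] by auto
  next
    case False
    then obtain e0 where "e0 \<in> edges G"
      by blast
    then obtain v where v: "v \<in> verts G" "e0 \<in> incident G v"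
      using edge_ends by metis
    obtain x y z where xyz: "incident G v = {x, y, z}" "x \<noteq> y" "x \<noteq> z" "y \<noteq> z"
      using incident_three[OF v(1)] .
    have E: "x \<in> edges G" "y \<in> edges G" "z \<in> edges G"
      using xyz by (auto simp: incident_def)
    have g3: "g x \<noteq> g y" "g x \<noteq> g z" "g y \<noteq> g z"
      using inj_on_incident[OF g v(1)] xyz by (auto simp: inj_on_def)
    \<comment> \<open>Stated for an arbitrary flow agreeing with \<open>g\<close> at
      \<open>x\<close>, so that it applies both to the given flow and to the outcome of the first
      transposition.\<close>
    have *: "(f, g) \<in> reach (flow_graph G)"
      if f: "f \<in> nowhere_zero_flows G"
        and fx: "f x = g x"
        and same: "\<And>e e'. e \<in> edges G \<Longrightarrow> e' \<in> edges G \<Longrightarrow> f e = f e' \<Longrightarrow> g e = g e'" for f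
    proof -
      have f3: "f x \<noteq> f y" "f x \<noteq> f z" "f y \<noteq> f z"
        using inj_on_incident[OF f v(1)] xyz by (auto simp: inj_on_def)
      have nz: "f x \<noteq> 0" "f y \<noteq> 0" "f z \<noteq> 0" "g x \<noteq> 0" "g y \<noteq> 0" "g z \<noteq> 0"
        using E nowhere_zero_flow_values f g by auto
      \<comment> \<open>All three values of \<open>f\<close> occur at \<open>v\<close>, so the edges
        \<open>x\<close>, \<open>y\<close>, \<open>z\<close> represent all classes and decide the
        relabelling from \<open>f\<close> to \<open>g\<close>.\<close>
      have cases: "e \<in> edges G \<Longrightarrow> f e = f x \<and> g e = g x \<or> f e = f y \<and> g e = g y
          \<or> f e = f z \<and> g e = g z" for e
      proof -
        assume e: "e \<in> edges G"
        have "f e \<in> f ` incident G v"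
          using image_incident[OF f v(1)] nowhere_zero_flow_values[OF f e] klein_nonzero_iff
          by metis
        then show ?thesis
          using xyz same[OF e] E by auto
      qed
      show ?thesis
      proof (cases "f y = g y")
        case True
        have "f z = g z"
          using klein_third[of "f x" "f y" "f z"] klein_third[of "g x" "g y" "g z"]
            f3 g3 nz True fx by auto
        then have "f e = g e" if "e \<in> edges G" for e
          using cases[OF that] True fx by auto
        then show ?thesis
          using ext[OF f g] refl[OF f] by metis
      next
        case False
        \<comment> \<open>With the value at \<open>x\<close> already right and that at
          \<open>y\<close> wrong, \<open>f\<close> and \<open>g\<close> differ by exchanging the two
          values other than \<open>g x\<close>, that is, by adding \<open>g x\<close> off the class
          of \<open>x\<close>.\<close>
        have "g y = f y + g x" "g z = g y + g x" "f z = f y + g x"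
          using False fx f3 g3 nz
          by (intro klein_third; simp)+
        then have yz: "g y = f y + g x" "g z = f z + g x"
          by simp_all
        let ?h = "switch G f (g x) {e \<in> edges G. f e \<noteq> g x}"
        have "?h e = g e" if "e \<in> edges G" for e
          using cases[OF that] that yz fx f3 by (auto simp: switch_def)
        then have "?h = g"
          using ext switch_all_reach(2)[OF f nz(4)] g by blast
        then show ?thesis
          using switch_all_reach(1)[OF f nz(4)] by simp
      qed
    qed
    show ?thesis
    proof (cases "f x = g x")
      case True
      then show ?thesis
        using *[OF f] flow_coloring_same_value[OF f g eq] by blast
    next
      case False
      \<comment> \<open>Adding this value exchanges \<open>f x\<close> and \<open>g x\<close>, so
        the switched flow agrees with \<open>g\<close> at \<open>x\<close>.\<close>
      define a where "a = f x + g x"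
      have a: "a \<noteq> 0"
        using False by (simp add: a_def klein_add_eq_0_iff)
      let ?h = "switch G f a {e \<in> edges G. f e \<noteq> a}"
      have nz: "f x \<noteq> 0" "g x \<noteq> 0"
        using E nowhere_zero_flow_values f g by auto
      have "?h x = g x"
        using E(1) nz
        by (cases "f x" rule: klein_cases; cases "g x" rule: klein_cases)
          (auto simp: switch_def a_def klein_zero)
      moreover have "g e = g e'" if "e \<in> edges G" "e' \<in> edges G" "?h e = ?h e'" for e e'
      proof -
        have "f e \<noteq> 0" "f e' \<noteq> 0"
          using that nowhere_zero_flow_values f by auto
        \<comment> \<open>Switching acts on nonzero values as a permutation: a switched edge never
          acquires the value \<open>a\<close>, since that would require \<open>f\<close> to be zero
          on it.\<close>
        then have "f e = f e'"
          using that by (auto simp: switch_def split: if_splits)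
        then show ?thesis
          using that flow_coloring_same_value[OF f g eq] by blast
      qed
      ultimately have "(?h, g) \<in> reach (flow_graph G)"
        using *[OF switch_all_reach(2)[OF f a]] by blast
      then show ?thesis
        by (rule reach_trans[OF switch_all_reach(1)[OF f a]])
    qed
  qed
qed

section \<open>Colourings and flows\<close>

text \<open>A bijection from the colours 0, 1, 2 to the nonzero elements. All larger numbers also go
  to \<open>(1, 1)\<close>, so injectivity needs the bound 3.\<close>

definition klein_of_color :: "nat \<Rightarrow> bit \<times> bit" where
  "klein_of_color i = (if i = 0 then (0, 1) else if i = 1 then (1, 0) else (1, 1))"

definition color_of_klein :: "bit \<times> bit \<Rightarrow> nat" where
  "color_of_klein x = (if x = (0, 1) then 0 else if x = (1, 0) then 1 else 2)"

lemma less_3_cases: "(i :: nat) < 3 \<longleftrightarrow> i = 0 \<or> i = 1 \<or> i = 2"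
  by auto

lemma color_of_klein_of_color: "i < 3 \<Longrightarrow> color_of_klein (klein_of_color i) = i"
  by (auto simp: less_3_cases color_of_klein_def klein_of_color_def)

lemma klein_of_color_of_klein: "x \<noteq> 0 \<Longrightarrow> klein_of_color (color_of_klein x) = x"
  by (cases x rule: klein_cases) (auto simp: color_of_klein_def klein_of_color_def klein_zero)

lemma klein_of_color_nonzero: "klein_of_color i \<noteq> 0"
  by (auto simp: klein_of_color_def klein_zero)

lemma color_of_klein_less: "color_of_klein x < 3"
  by (simp add: color_of_klein_def)

lemma klein_of_color_eq_iff:
  "i < 3 \<Longrightarrow> j < 3 \<Longrightarrow> klein_of_color i = klein_of_color j \<longleftrightarrow> i = j"
  by (metis color_of_klein_of_color)

text \<open>In a group of exponent two, adding the sum of two elements to either of them yields the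
  other.\<close>

lemma klein_of_color_transpose:
  assumes "i < 3" "j < 3" "i \<noteq> j" "k = i \<or> k = j"
  shows "klein_of_color (Transposition.transpose i j k) =
    klein_of_color k + (klein_of_color i + klein_of_color j)"
  using assms by (auto simp: less_3_cases klein_of_color_def) (simp_all add: klein_zero)

lemma klein_of_color_third:
  assumes "i < 3" "j < 3" "i \<noteq> j" "k < 3"
  shows "klein_of_color k \<noteq> klein_of_color i + klein_of_color j \<longleftrightarrow> k = i \<or> k = j"
  using assms by (auto simp: less_3_cases klein_of_color_def) (simp_all add: klein_zero)

text \<open>Each nonzero element is the sum of the two others; this supplies the pair of colours
  that a switch by \<open>a\<close> exchanges.\<close>

lemma nonzero_eq_add_colors:
  assumes "a \<noteq> 0"
  obtains i j where "i < 3" "j < 3" "i \<noteq> j" "a = klein_of_color i + klein_of_color j"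
proof -
  have "a = klein_of_color 1 + klein_of_color 2 \<or> a = klein_of_color 0 + klein_of_color 2
    \<or> a = klein_of_color 0 + klein_of_color 1"
    using assms by (cases a rule: klein_cases) (auto simp: klein_of_color_def klein_zero)
  then show ?thesis
    using that[of 1 2] that[of 0 2] that[of 0 1] by auto
qed

definition flow_of_coloring :: "('e \<Rightarrow> nat) \<Rightarrow> 'e \<Rightarrow> bit \<times> bit" where
  "flow_of_coloring c = (\<lambda>e \<in> edges G. klein_of_color (c e))"

definition coloring_of_flow :: "('e \<Rightarrow> bit \<times> bit) \<Rightarrow> 'e \<Rightarrow> nat" where
  "coloring_of_flow f = (\<lambda>e \<in> edges G. color_of_klein (f e))"

lemma flow_of_coloring_of_flow:
  assumes "f \<in> nowhere_zero_flows G"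
  shows "flow_of_coloring (coloring_of_flow f) = f"
proof
  fix e
  show "flow_of_coloring (coloring_of_flow f) e = f e"
    using assms nowhere_zero_flow_values[OF assms]
    by (cases "e \<in> edges G")
      (auto simp: flow_of_coloring_def coloring_of_flow_def klein_of_color_of_klein
        nowhere_zero_flow_iff)
qed

lemma coloring_of_flow_proper:
  assumes f: "f \<in> nowhere_zero_flows G"
  shows "coloring_of_flow f \<in> proper_colorings G 3"
proof -
  have "ends G e \<inter> ends G e' = {}"
    if e: "e \<in> edges G" "e' \<in> edges G" "e \<noteq> e'" "color_of_klein (f e) = color_of_klein (f e')"
    for e e'
  proof (rule ccontr)
    assume "ends G e \<inter> ends G e' \<noteq> {}"
    then obtain v where v: "v \<in> ends G e" "v \<in> ends G e'"
      by blast
    then have "v \<in> verts G"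
      using e multigraph by (auto simp: multigraph_def)
    moreover have "f e = f e'"
      using e nowhere_zero_flow_values[OF f] by (metis klein_of_color_of_klein)
    ultimately show False
      using inj_on_incident[OF f] e v by (auto simp: inj_on_def incident_def)
  qed
  then show ?thesis
    by (auto simp: proper_colorings_def coloring_of_flow_def matching_def color_of_klein_less)
qed

text \<open>Properness gives distinct values at each vertex. Cubicity enters through
  \<open>nowhere_zero_flow_iff\<close>, which turns three distinct nonzero values into a zero
  sum.\<close>

lemma flow_of_proper_coloring:
  assumes c: "c \<in> proper_colorings G 3"
  shows "flow_of_coloring c \<in> nowhere_zero_flows G"
proof -
  have less: "c e < 3" if "e \<in> edges G" for e
    using c that by (auto simp: proper_colorings_def)
  have "e = e'" if v: "e \<in> incident G v" "e' \<in> incident G v" "klein_of_color (c e) = klein_of_color (c e')"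
    for v e e'
  proof (rule ccontr)
    assume ne: "e \<noteq> e'"
    have E: "e \<in> edges G" "e' \<in> edges G" "v \<in> ends G e \<inter> ends G e'"
      using v by (auto simp: incident_def)
    then have "c e = c e'"
      using v(3) less klein_of_color_eq_iff by blast
    moreover have "matching G {x \<in> edges G. c x = c e}"
      using c less[OF E(1)] by (simp add: proper_colorings_def)
    ultimately show False
      using E ne by (auto simp: matching_def)
  qed
  moreover have "incident G v \<subseteq> edges G" for v
    by (auto simp: incident_def)
  ultimately show ?thesis
    by (auto simp: nowhere_zero_flow_iff flow_of_coloring_def klein_of_color_nonzero inj_on_def
        subset_iff)
qed

text \<open>Only the range of \<open>c\<close> is assumed, so that the result of a Kempe change can
  be treated without first proving it proper.\<close>

lemma flow_coloring_of_coloring: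
  assumes "\<And>e. e \<in> edges G \<Longrightarrow> c e < 3"
  shows "flow_coloring G (flow_of_coloring c) = color_classes G 3 c"
proof -
  have im: "{(0, 1), (1, 0), (1, 1)} = klein_of_color ` {..<3}"
    by (auto simp: klein_of_color_def less_3_cases image_iff)
  have cls: "{e \<in> edges G. flow_of_coloring c e = klein_of_color i} = {e \<in> edges G. c e = i}"
    if "i < 3" for i
    using assms that by (auto simp: flow_of_coloring_def klein_of_color_eq_iff)
  show ?thesis
    unfolding flow_coloring_def color_classes_def im image_image
    using cls by (intro arg_cong2[where f = "(-)"] image_cong) auto
qed

lemma flow_coloring_unlabelled:
  assumes f: "f \<in> nowhere_zero_flows G"
  shows "flow_coloring G f \<in> unlabelled_colorings G 3"
proof -
  let ?c = "coloring_of_flow f"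
  have c: "?c \<in> proper_colorings G 3"
    using coloring_of_flow_proper[OF f] .
  then have less: "?c e < 3" if "e \<in> edges G" for e
    using that by (auto simp: proper_colorings_def)
  have eq: "flow_coloring G f = color_classes G 3 ?c"
    using flow_coloring_of_coloring[of ?c, OF less] flow_of_coloring_of_flow[OF f] by simp
  have "partition_on (edges G) (color_classes G 3 ?c)"
    using less by (auto simp: partition_on_def disjoint_def color_classes_def)
  moreover have "card (color_classes G 3 ?c) \<le> 3"
  proof -
    have "card (color_classes G 3 ?c) \<le> card ((\<lambda>i. {e \<in> edges G. ?c e = i}) ` {..<3 :: nat})"
      unfolding color_classes_def by (intro card_mono) auto
    also have "\<dots> \<le> 3"
      using card_image_le[of "{..<3 :: nat}"] by (metis card_lessThan finite_lessThan)
    finally show ?thesis .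
  qed
  moreover have "finite (color_classes G 3 ?c)"
    by (simp add: color_classes_def)
  moreover have "\<forall>M \<in> color_classes G 3 ?c. matching G M"
    using c by (auto simp: proper_colorings_def color_classes_def)
  ultimately show ?thesis
    by (simp add: unlabelled_colorings_def eq)
qed

section \<open>Kempe changes as switches of flows\<close>

lemma kempe_chains_eq_components:
  assumes "\<And>e. e \<in> edges G \<Longrightarrow> c e < 3" "i < 3" "j < 3" "i \<noteq> j"
  shows "kempe_chains G c i j =
    components (two_valued_subgraph G (flow_of_coloring c) (klein_of_color i + klein_of_color j))"
proof -
  have "{e \<in> edges G. c e \<in> {i, j}} =
      {e \<in> edges G. flow_of_coloring c e \<noteq> klein_of_color i + klein_of_color j}"
    using assms klein_of_color_third[OF assms(2-4)] by (auto simp: flow_of_coloring_def)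
  then show ?thesis
    by (simp add: kempe_chains_def two_valued_subgraph_def)
qed

lemma flow_of_kempe_change:
  assumes less: "\<And>e. e \<in> edges G \<Longrightarrow> c e < 3" and ij: "i < 3" "j < 3" "i \<noteq> j"
    and H: "H \<in> kempe_chains G c i j"
  shows "flow_of_coloring (\<lambda>e. if e \<in> edges H then Transposition.transpose i j (c e) else c e) =
    switch G (flow_of_coloring c) (klein_of_color i + klein_of_color j) (edges H)"
proof -
  have "c e = i \<or> c e = j" if "e \<in> edges H" for e
    using that H
    by (auto simp: kempe_chains_def components_def induced_subgraph_def edge_subgraph_def)
  then show ?thesis
    using klein_of_color_transpose[OF ij]
    by (auto simp: flow_of_coloring_def switch_def fun_eq_iff)
qed

lemma transpose_less_3:
  "i < 3 \<Longrightarrow> j < 3 \<Longrightarrow> (k :: nat) < 3 \<Longrightarrow> Transposition.transpose i j k < 3"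
  by (simp add: Transposition.transpose_def)

text \<open>The labelling \<open>c\<close> determines the pair of flows, so only some flows over the
  two colourings are related here; \<open>same_flow_coloring_reach\<close> extends this to all of
  them.\<close>

lemma kempe_adjacent_imp_flows:
  assumes c: "c \<in> proper_colorings G 3" and kc: "kempe_change G 3 c c'"
  obtains f f' where "f \<in> nowhere_zero_flows G" "f' \<in> nowhere_zero_flows G"
    "flow_coloring G f = color_classes G 3 c" "flow_coloring G f' = color_classes G 3 c'"
    "(f, f') \<in> reach (flow_graph G)"
proof -
  have less: "c e < 3" if "e \<in> edges G" for e
    using c that by (auto simp: proper_colorings_def)
  obtain i j H where ij: "i < 3" "j < 3" "i \<noteq> j" and H: "H \<in> kempe_chains G c i j"
    and c': "c' = (\<lambda>e. if e \<in> edges H then Transposition.transpose i j (c e) else c e)"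
    using kc by (auto simp: kempe_change_def)
  have less': "c' e < 3" if "e \<in> edges G" for e
    using less[OF that] ij by (simp add: c' transpose_less_3)
  define a where "a = klein_of_color i + klein_of_color j"
  have a: "a \<noteq> 0"
    using ij by (simp add: a_def klein_add_eq_0_iff klein_of_color_eq_iff)
  have f: "flow_of_coloring c \<in> nowhere_zero_flows G"
    using flow_of_proper_coloring[OF c] .
  have H': "H \<in> components (two_valued_subgraph G (flow_of_coloring c) a)"
    using H kempe_chains_eq_components[OF less ij] by (simp add: a_def)
  have f': "flow_of_coloring c' = switch G (flow_of_coloring c) a (edges H)"
    using flow_of_kempe_change[OF less ij H] by (simp add: c' a_def)
  show ?thesis
    using that[OF f _ flow_coloring_of_coloring[of c, OF less] flow_coloring_of_coloring[of c', OF less']]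
      switch_nowhere_zero_flow[OF f a H'] switch_reach[OF f a H'] f' by simp
qed

lemma flow_adjacent_imp_kempe:
  assumes f: "f \<in> nowhere_zero_flows G" and g: "g \<in> nowhere_zero_flows G"
    and C: "is_cycle G C" and diff: "{e \<in> edges G. f e - g e \<noteq> 0} = edges C"
  shows "(flow_coloring G f, flow_coloring G g) \<in> reach (kempe_graph G 3)"
proof -
  obtain a H where a: "a \<noteq> 0" and H: "H \<in> components (two_valued_subgraph G f a)"
    and gs: "g = switch G f a (edges H)"
    using cycle_difference_is_switch[OF f g C diff] .
  obtain i j where ij: "i < 3" "j < 3" "i \<noteq> j" and aij: "a = klein_of_color i + klein_of_color j"
    using nonzero_eq_add_colors[OF a] .
  let ?c = "coloring_of_flow f"
  have c: "?c \<in> proper_colorings G 3"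
    using coloring_of_flow_proper[OF f] .
  then have less: "?c e < 3" if "e \<in> edges G" for e
    using that by (auto simp: proper_colorings_def)
  have fc: "flow_of_coloring ?c = f"
    using flow_of_coloring_of_flow[OF f] .
  have H': "H \<in> kempe_chains G ?c i j"
    using H kempe_chains_eq_components[OF less ij] by (simp add: aij fc)
  define c' where "c' = (\<lambda>e. if e \<in> edges H then Transposition.transpose i j (?c e) else ?c e)"
  have less': "c' e < 3" if "e \<in> edges G" for e
    using less[OF that] ij by (simp add: c'_def transpose_less_3)
  have "flow_of_coloring c' = g"
    using flow_of_kempe_change[OF less ij H'] by (simp add: c'_def fc gs aij)
  then have "color_classes G 3 c' = flow_coloring G g"
    using flow_coloring_of_coloring[of c', OF less'] by simp
  moreover have "color_classes G 3 ?c = flow_coloring G f"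
    using flow_coloring_of_coloring[of ?c, OF less] fc by simp
  moreover have "kempe_change G 3 ?c c'"
    using ij H' by (auto simp: kempe_change_def c'_def)
  ultimately show ?thesis
    using flow_coloring_unlabelled f g c unfolding kempe_graph_def
    by (intro simple_graph_reach_adj) blast+
qed

end

theorem theorem4p3:
  fixes G :: "('v, 'e) mgraph"
    and f g :: "'e \<Rightarrow> bit \<times> bit"
    and c d :: "'e set set"
  assumes "finite_multigraph G" and "cubic G"
    and "f \<in> nowhere_zero_flows G" and "g \<in> nowhere_zero_flows G"
    and "c = flow_coloring G f" and "d = flow_coloring G g"
  shows "same_component (flow_graph G) f g \<longleftrightarrow> same_component (kempe_graph G 3) c d"
proof -
  interpret finite_cubic_graph G
    using assms(1,2) by unfold_locales
  let ?F = "reach (flow_graph G)" and ?K = "reach (kempe_graph G 3)"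
  have "(f, g) \<in> ?F \<longleftrightarrow> (c, d) \<in> ?K"
  proof
    assume "(f, g) \<in> ?F"
    then have "(flow_coloring G f, flow_coloring G g) \<in> ?K"
      unfolding flow_graph_def
    proof (rule simple_graph_reach_invariant[where P = "\<lambda>h. (flow_coloring G f, flow_coloring G h) \<in> ?K"])
      show "(flow_coloring G f, flow_coloring G f) \<in> ?K"
        using flow_coloring_unlabelled[OF assms(3)]
        by (intro reach_refl) (simp add: kempe_graph_def simple_graph_def)
    next
      fix h k
      assume hk: "h \<in> nowhere_zero_flows G" "k \<in> nowhere_zero_flows G"
        and adj: "(\<exists>C. is_cycle G C \<and> {e \<in> edges G. h e - k e \<noteq> 0} = edges C) \<or>
          (\<exists>C. is_cycle G C \<and> {e \<in> edges G. k e - h e \<noteq> 0} = edges C)"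
        and h: "(flow_coloring G f, flow_coloring G h) \<in> ?K"
      have "(flow_coloring G h, flow_coloring G k) \<in> ?K"
        using adj flow_adjacent_imp_kempe[OF hk] reach_sym[OF flow_adjacent_imp_kempe[OF hk(2,1)]]
        by blast
      then show "(flow_coloring G f, flow_coloring G k) \<in> ?K"
        by (rule reach_trans[OF h])
    qed
    then show "(c, d) \<in> ?K"
      using assms by simp
  next
    assume "(c, d) \<in> ?K"
    \<comment> \<open>A vertex of the Kempe graph does not determine a flow, so the invariant
      quantifies over all flows with the given colouring; it starts and continues by
      \<open>same_flow_coloring_reach\<close>.\<close>
    then have "\<forall>h \<in> nowhere_zero_flows G. flow_coloring G h = d \<longrightarrow> (f, h) \<in> ?F"
      unfolding kempe_graph_def
    proof (rule simple_graph_reach_invariant[where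
          P = "\<lambda>P. \<forall>h \<in> nowhere_zero_flows G. flow_coloring G h = P \<longrightarrow> (f, h) \<in> ?F"])
      show "\<forall>h \<in> nowhere_zero_flows G. flow_coloring G h = c \<longrightarrow> (f, h) \<in> ?F"
        using same_flow_coloring_reach assms by auto
    next
      fix P Q
      assume "(\<exists>c c'. c \<in> proper_colorings G 3 \<and> color_classes G 3 c = P \<and>
            kempe_change G 3 c c' \<and> color_classes G 3 c' = Q) \<or>
          (\<exists>c c'. c \<in> proper_colorings G 3 \<and> color_classes G 3 c = Q \<and>
            kempe_change G 3 c c' \<and> color_classes G 3 c' = P)"
      then obtain p q where pq: "p \<in> nowhere_zero_flows G" "q \<in> nowhere_zero_flows G"
        "flow_coloring G p = P" "flow_coloring G q = Q" "(p, q) \<in> ?F"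
        by (elim disjE exE conjE) (metis kempe_adjacent_imp_flows reach_sym)+
      assume IH: "\<forall>h \<in> nowhere_zero_flows G. flow_coloring G h = P \<longrightarrow> (f, h) \<in> ?F"
      show "\<forall>h \<in> nowhere_zero_flows G. flow_coloring G h = Q \<longrightarrow> (f, h) \<in> ?F"
      proof (intro ballI impI)
        fix h assume "h \<in> nowhere_zero_flows G" "flow_coloring G h = Q"
        then have "(q, h) \<in> ?F"
          using same_flow_coloring_reach pq by simp
        moreover have "(f, p) \<in> ?F"
          using IH pq by blast
        ultimately show "(f, h) \<in> ?F"
          using reach_trans[OF reach_trans[OF _ pq(5)]] by blast
      qed
    qed
    then show "(f, g) \<in> ?F"
      using assms by simp
  qed
  then show ?thesis
    by (simp add: same_component_iff_reach)
qed

end
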